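(* Cut elimination holds for $\mathbf{SKt}+\mathbf P$, for any set $\mathbf P$ of path axioms.
   Context: Formulae are in negation normal form over $a,\neg a,\lor,\land,\square,\blacksquare,\lozenge,\lozenge^{\bullet}$, where $\lozenge^{\bullet}$ is the past diamond (dual of $\blacksquare$), $\overline A$ the nnf of $\neg A$. $\mathbf{SKt}$ is the shallow nested sequent calculus: $id$: $\Gamma,a,\overline a$; $cut$: from $\Gamma,A$ and $\Delta,\overline A$ infer $\Gamma,\Delta$; $\land$; $\lor$; $ctr$: from $\Gamma,\Delta,\Delta$ infer $\Gamma,\Delta$; $wk$: from $\Gamma$ infer $\Gamma,\Delta$; $rf$: from $\Gamma,\circ\{\Delta\}$ infer $\bullet\{\Gamma\},\Delta$; $rp$: from $\Gamma,\bullet\{\Delta\}$ infer $\circ\{\Gamma\},\Delta$; $\blacksquare$: from $\Gamma,\bullet\{A\}$ infer $\Gamma,\blacksquare A$; $\square$: from $\Gamma,\circ\{A\}$ infer $\Gamma,\square A$; $\lozenge^{\bullet}$: from $\Gamma,\bullet\{\Delta,A\}$ infer $\Gamma,\bullet\{\Delta\},\lozenge^{\bullet}A$; $\lozenge$: from $\Gamma,\circ\{\Delta,A\}$ infer $\Gamma,\circ\{\Delta\},\lozenge A$. A path axiom is a scheme $\langle?\rangle_1\cdots\langle?\rangle_n X\to\langle?\rangle X$, $n\ge0$, each diamond in $\{\lozenge,\lozenge^{\bullet}\}$. $\mathbf{SKt}+\mathbf P$ adds, for each axiom in $\mathbf P$, the structural rule: from $\Gamma,\star\{\Delta\}$ infer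 $\Gamma,\star_1\{\cdots\star_n\{\Delta\}\cdots\}$, where $\star$ ($\star_i$) is $\circ$ if $\langle?\rangle$ ($\langle?\rangle_i$) is $\lozenge$ and $\bullet$ if it is $\lozenge^{\bullet}$. *)

theory Defs
  imports "HOL-Library.Multiset"
begin

datatype 'a fm =
    Pos 'a
  | Neg 'a
  | Or "'a fm" "'a fm"
  | And "'a fm" "'a fm"
  | Box "'a fm"   \<comment> \<open>future modalities: \<open>Box\<close>, \<open>Dia\<close>\<close>
  | BBox "'a fm"  \<comment> \<open>past modalities: \<open>BBox\<close> (filled box) and its dual \<open>BDia\<close>\<close>
  | Dia "'a fm"
  | BDia "'a fm"

text \<open>The negation normal form of the negation of a formula.\<close>

primrec dual :: "'a fm \<Rightarrow> 'a fm" where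
  "dual (Pos a) = Neg a"
| "dual (Neg a) = Pos a"
| "dual (Or A B) = And (dual A) (dual B)"
| "dual (And A B) = Or (dual A) (dual B)"
| "dual (Box A) = Dia (dual A)"
| "dual (BBox A) = BDia (dual A)"
| "dual (Dia A) = Box (dual A)"
| "dual (BDia A) = BBox (dual A)"

text \<open>
  A nested sequent is a finite multiset whose elements are formulae and the structures
  \<open>Circ \<Delta>\<close> (white circle) and \<open>Bullet \<Delta>\<close> (black circle) around a nested sequent \<open>\<Delta>\<close>.
  The comma is multiset union; the empty sequent is allowed everywhere, also inside
  the two structural connectives.
\<close>

datatype 'a item =
    Fm "'a fm"
  | Circ "'a item multiset"
  | Bullet "'a item multiset"

type_synonym 'a sequent = "'a item multiset"

datatype tense = Future | Past

primrec dia :: "tense \<Rightarrow> 'a fm \<Rightarrow> 'a fm" where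
  "dia Future = Dia"
| "dia Past = BDia"

primrec star :: "tense \<Rightarrow> 'a sequent \<Rightarrow> 'a item" where
  "star Future = Circ"
| "star Past = Bullet"

text \<open>
  A path axiom is a scheme, determined by the list of diamonds in its antecedent (possibly
  empty) and the single diamond in its succedent; its instance at the formula \<open>X\<close> is
  \<open>path_inst\<close>, where the implication is written in negation normal form.
\<close>

datatype path_axiom = PathAxiom "tense list" tense

primrec path_inst :: "path_axiom \<Rightarrow> 'a fm \<Rightarrow> 'a fm" where
  "path_inst (PathAxiom ts t) X = Or (dual (foldr dia ts X)) (dia t X)"

text \<open>
  \<open>nest [t\<^sub>1, \<dots>, t\<^sub>n] \<Delta>\<close> wraps \<open>\<Delta>\<close> in \<open>n\<close> structural connectives, the one for \<open>t\<^sub>1\<close> outermost.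
  For \<open>n = 0\<close> it is \<open>\<Delta>\<close> itself, so that \<open>\<Gamma> + nest [] \<Delta>\<close> is the sequent written \<open>\<Gamma>, \<Delta>\<close>.
\<close>

primrec nest :: "tense list \<Rightarrow> 'a sequent \<Rightarrow> 'a sequent" where
  "nest [] \<Delta> = \<Delta>"
| "nest (t # ts) \<Delta> = {#star t (nest ts \<Delta>)#}"

text \<open>
  Derivability in the calculus extended with the structural rules of the path axioms in \<open>P\<close>.
  The Boolean \<open>c\<close> says whether the rule \<open>cut\<close> belongs to the calculus.
\<close>

inductive derivable :: "bool \<Rightarrow> path_axiom set \<Rightarrow> 'a sequent \<Rightarrow> bool"
  for c :: bool and P :: "path_axiom set" where
  id: "derivable c P (\<Gamma> + {#Fm (Pos a), Fm (Neg a)#})"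
| cut: "c \<Longrightarrow> derivable c P (\<Gamma> + {#Fm A#}) \<Longrightarrow> derivable c P (\<Delta> + {#Fm (dual A)#})
    \<Longrightarrow> derivable c P (\<Gamma> + \<Delta>)"
| conj: "derivable c P (\<Gamma> + {#Fm A#}) \<Longrightarrow> derivable c P (\<Gamma> + {#Fm B#})
    \<Longrightarrow> derivable c P (\<Gamma> + {#Fm (And A B)#})"
| disj: "derivable c P (\<Gamma> + {#Fm A, Fm B#}) \<Longrightarrow> derivable c P (\<Gamma> + {#Fm (Or A B)#})"
| ctr: "derivable c P (\<Gamma> + \<Delta> + \<Delta>) \<Longrightarrow> derivable c P (\<Gamma> + \<Delta>)"
| wk: "derivable c P \<Gamma> \<Longrightarrow> derivable c P (\<Gamma> + \<Delta>)"
| rf: "derivable c P (\<Gamma> + {#Circ \<Delta>#}) \<Longrightarrow> derivable c P ({#Bullet \<Gamma>#} + \<Delta>)"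
| rp: "derivable c P (\<Gamma> + {#Bullet \<Delta>#}) \<Longrightarrow> derivable c P ({#Circ \<Gamma>#} + \<Delta>)"
| bbox: "derivable c P (\<Gamma> + {#Bullet {#Fm A#}#}) \<Longrightarrow> derivable c P (\<Gamma> + {#Fm (BBox A)#})"
| box: "derivable c P (\<Gamma> + {#Circ {#Fm A#}#}) \<Longrightarrow> derivable c P (\<Gamma> + {#Fm (Box A)#})"
| bdia: "derivable c P (\<Gamma> + {#Bullet (\<Delta> + {#Fm A#})#})
    \<Longrightarrow> derivable c P (\<Gamma> + {#Bullet \<Delta>, Fm (BDia A)#})"
| dia: "derivable c P (\<Gamma> + {#Circ (\<Delta> + {#Fm A#})#})
    \<Longrightarrow> derivable c P (\<Gamma> + {#Circ \<Delta>, Fm (Dia A)#})"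
| path: "PathAxiom ts t \<in> P \<Longrightarrow> derivable c P (\<Gamma> + {#star t \<Delta>#})
    \<Longrightarrow> derivable c P (\<Gamma> + nest ts \<Delta>)"

abbreviation SKt :: "path_axiom set \<Rightarrow> 'a sequent \<Rightarrow> bool" where
  "SKt \<equiv> derivable True"

abbreviation SKt_cut_free :: "path_axiom set \<Rightarrow> 'a sequent \<Rightarrow> bool" where
  "SKt_cut_free \<equiv> derivable False"

end

(*
  Semantic cut elimination in the style of Okada's phase semantics.  Two sequents are called
  orthogonal if their union is cut-free derivable, and every formula A is interpreted by a
  biorthogonally closed set V(A) of sequents.  The interpretation turns duality into
  orthogonality, and {A} is always orthogonal to V(A).  Every derivation, even with cuts, is
  sound in the following sense: replacing each formula occurrence A of the endsequent by any
  sequent orthogonal to V(A) yields a cut-free derivable sequent.  Replacing each A by itself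
  gives the theorem.  The path rules cause no difficulty, as they are closed under replacing
  formulae by sequents.
*)
theory Submission
  imports Defs "HOL-Library.Set_Algebras"
begin

section \<open>Residuation and derived rules, uniform in the presence of cut\<close>

primrec conv :: "tense \<Rightarrow> tense" where
  "conv Future = Past"
| "conv Past = Future"

lemma conv_conv [simp]: "conv (conv t) = t"
  by (cases t) auto

lemma residuation1:
  "derivable c P (\<Gamma> + {#star t \<Delta>#}) \<Longrightarrow> derivable c P (\<Delta> + {#star (conv t) \<Gamma>#})"
  using derivable.rf[of c P \<Gamma> \<Delta>] derivable.rp[of c P \<Gamma> \<Delta>] by (cases t) simp_all

lemma residuation:
  "derivable c P (\<Gamma> + {#star t \<Delta>#}) \<longleftrightarrow> derivable c P (\<Delta> + {#star (conv t) \<Gamma>#})"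
  using residuation1[of c P \<Gamma> t \<Delta>] residuation1[of c P \<Delta> "conv t" \<Gamma>] by auto

lemma weaken_nested:
  assumes "derivable c P (\<Gamma> + {#star t \<Delta>#})"
  shows "derivable c P (\<Gamma> + {#star t (\<Delta> + \<Theta>)#})"
proof -
  have "derivable c P (\<Delta> + {#star (conv t) \<Gamma>#} + \<Theta>)"
    by (intro derivable.wk residuation1 assms)
  then have "derivable c P (\<Delta> + \<Theta> + {#star (conv t) \<Gamma>#})"
    by (simp add: ac_simps)
  then show ?thesis
    by (subst residuation)
qed

text \<open>Weakening inside each of the two structures makes them equal, and then they
  contract.\<close>

lemma merge_nested:
  assumes "derivable c P (\<Gamma> + {#star t \<Delta>#} + {#star t \<Theta>#})"
  shows "derivable c P (\<Gamma> + {#star t (\<Delta> + \<Theta>)#})"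
proof -
  have "derivable c P (\<Gamma> + {#star t \<Delta>#} + {#star t (\<Theta> + \<Delta>)#})"
    using assms by (rule weaken_nested)
  then have "derivable c P ((\<Gamma> + {#star t (\<Delta> + \<Theta>)#}) + {#star t \<Delta>#})"
    by (simp add: ac_simps)
  then have "derivable c P ((\<Gamma> + {#star t (\<Delta> + \<Theta>)#}) + {#star t (\<Delta> + \<Theta>)#})"
    by (rule weaken_nested)
  then show ?thesis
    by (rule derivable.ctr)
qed

lemma diamond:
  assumes "derivable c P (\<Gamma> + {#star t (\<Delta> + {#Fm A#})#})"
  shows "derivable c P (\<Gamma> + {#star t \<Delta>, Fm (dia t A)#})"
  using assms derivable.dia[of c P \<Gamma> \<Delta> A] derivable.bdia[of c P \<Gamma> \<Delta> A] by (cases t) simp_all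

text \<open>Weaken by a structure around the empty sequent; residuation turns it into an empty
  context.\<close>

lemma necessitation: "derivable c P \<Gamma> \<Longrightarrow> derivable c P {#star t \<Gamma>#}"
  using derivable.wk[of c P \<Gamma> "{#star (conv t) {#}#}"] residuation[of c P "{#}" t \<Gamma>] by auto

section \<open>Orthogonality\<close>

definition orth :: "path_axiom set \<Rightarrow> 'a sequent set \<Rightarrow> 'a sequent set" where
  "orth P X = {\<Gamma>. \<forall>\<Delta>\<in>X. SKt_cut_free P (\<Gamma> + \<Delta>)}"

lemma orthI: "(\<And>\<Delta>. \<Delta> \<in> X \<Longrightarrow> SKt_cut_free P (\<Gamma> + \<Delta>)) \<Longrightarrow> \<Gamma> \<in> orth P X"
  by (simp add: orth_def)

lemma orthD: "\<Gamma> \<in> orth P X \<Longrightarrow> \<Delta> \<in> X \<Longrightarrow> SKt_cut_free P (\<Gamma> + \<Delta>)"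
  by (simp add: orth_def)

text \<open>Multiset union commutes, so \<open>orth P\<close> forms an antitone Galois connection
  with itself; biorthogonal closure comes from this.\<close>

lemma subset_orth_iff: "X \<subseteq> orth P Y \<longleftrightarrow> Y \<subseteq> orth P X"
  unfolding orth_def by (simp add: subset_iff) (metis add.commute)

lemma subset_orth_single_iff: "X \<subseteq> orth P {\<Gamma>} \<longleftrightarrow> \<Gamma> \<in> orth P X"
  by (subst subset_orth_iff) simp

lemma orth_antimono: "X \<subseteq> Y \<Longrightarrow> orth P Y \<subseteq> orth P X"
  by (auto simp: orth_def)

lemma subset_biorth: "X \<subseteq> orth P (orth P X)"
  by (subst subset_orth_iff) simp

lemma orth_orth_orth [simp]: "orth P (orth P (orth P X)) = orth P X"
  by (intro equalityI subset_biorth orth_antimono)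

section \<open>Interpretation of formulae\<close>

primrec val :: "path_axiom set \<Rightarrow> 'a fm \<Rightarrow> 'a sequent set" where
  "val P (Pos a) = orth P {{#Fm (Pos a)#}}"
| "val P (Neg a) = orth P (orth P {{#Fm (Pos a)#}})"
| "val P (Or A B) = orth P (orth P (val P A) \<inter> orth P (val P B))"
| "val P (And A B) = val P A \<inter> val P B"
| "val P (Box A) = orth P ((\<lambda>\<Delta>. {#Circ \<Delta>#}) ` orth P (val P A))"
| "val P (BBox A) = orth P ((\<lambda>\<Delta>. {#Bullet \<Delta>#}) ` orth P (val P A))"
| "val P (Dia A) = orth P (orth P ((\<lambda>\<Delta>. {#Circ \<Delta>#}) ` val P A))"
| "val P (BDia A) = orth P (orth P ((\<lambda>\<Delta>. {#Bullet \<Delta>#}) ` val P A))"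

lemma orth_Un: "orth P (X \<union> Y) = orth P X \<inter> orth P Y"
  by (auto simp: orth_def)

text \<open>Only the clause for \<open>And\<close> is not visibly an orthogonal; an intersection of
  closed sets is the orthogonal of a union.\<close>

lemma biorth_val [simp]: "orth P (orth P (val P A)) = val P A"
proof (induction A)
  case (And A B)
  have "val P (And A B) = orth P (orth P (val P A) \<union> orth P (val P B))"
    using And by (simp add: orth_Un)
  then show ?case
    by (simp only: orth_orth_orth)
qed simp_all

lemma val_dual: "val P (dual A) = orth P (val P A)"
  by (induction A) (simp_all flip: orth_Un)

lemma val_dia: "val P (dia t A) = orth P (orth P ((\<lambda>\<Delta>. {#star t \<Delta>#}) ` val P A))"
  by (cases t) simp_all

text \<open>The induction proves the equivalent inclusion of \<open>val P A\<close> in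
  \<open>orth P {{#Fm A#}}\<close>. As the latter set is closed, a biorthogonal lies in it once its
  generators do.\<close>

lemma formula_in_orth_val: "{#Fm A#} \<in> orth P (val P A)"
proof -
  have modal: "val P (dia t A) \<subseteq> orth P {{#Fm (dia t A)#}}"
    if *: "val P A \<subseteq> orth P {{#Fm A#}}" for t A
  proof -
    have "{#star t \<Delta>#} \<in> orth P {{#Fm (dia t A)#}}" if "\<Delta> \<in> val P A" for \<Delta>
    proof -
      have "SKt_cut_free P (\<Delta> + {#Fm A#})"
        using * that by (auto simp: orth_def)
      from diamond[of False P "{#}", OF _ , of t \<Delta> A] necessitation[OF this, of t]
      show ?thesis by (auto simp: orth_def add_mset_commute)
    qed
    then have "(\<lambda>\<Delta>. {#star t \<Delta>#}) ` val P A \<subseteq> orth P {{#Fm (dia t A)#}}"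
      by blast
    then show ?thesis
      unfolding val_dia by (metis orth_antimono orth_orth_orth)
  qed
  have boxed: "SKt_cut_free P (\<Gamma> + {#star t {#Fm A#}#})"
    if "{#Fm A#} \<in> orth P (val P A)" "\<Gamma> \<in> orth P ((\<lambda>\<Delta>. {#star t \<Delta>#}) ` orth P (val P A))"
    for \<Gamma> t A
    using that by (auto simp: orth_def)
  have "val P A \<subseteq> orth P {{#Fm A#}}"
  proof (induction A)
    case (Neg a)
    have "SKt_cut_free P {#Fm (Pos a), Fm (Neg a)#}"
      using derivable.id[of False P "{#}"] by simp
    then have "{#Fm (Neg a)#} \<in> orth P {{#Fm (Pos a)#}}"
      by (simp add: orth_def add_mset_commute)
    then show ?case
      by (simp add: orth_antimono)
  next
    case (Or A B)
    \<comment> \<open>The value of \<open>Or A B\<close> is the biorthogonal of this union, so one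
      disjunct is at hand and weakening supplies the other.\<close>
    have "{#Fm (Or A B)#} \<in> orth P (val P A \<union> val P B)"
    proof (rule orthI)
      fix \<Gamma> assume "\<Gamma> \<in> val P A \<union> val P B"
      then have "SKt_cut_free P (\<Gamma> + {#Fm A#}) \<or> SKt_cut_free P (\<Gamma> + {#Fm B#})"
        using Or by (auto simp: orth_def)
      then have "SKt_cut_free P (\<Gamma> + {#Fm A, Fm B#})"
        using derivable.wk[of False P "\<Gamma> + {#Fm A#}" "{#Fm B#}"]
          derivable.wk[of False P "\<Gamma> + {#Fm B#}" "{#Fm A#}"]
        by (auto simp: add_mset_commute)
      from derivable.disj[OF this] show "SKt_cut_free P ({#Fm (Or A B)#} + \<Gamma>)"
        by simp
    qed
    then show ?case
      by (simp add: orth_antimono flip: orth_Un)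
  next
    case (And A B)
    then show ?case
      using derivable.conj[of False P _ A B] by (auto simp: orth_def)
  next
    case (Box A)
    then have "{#Fm A#} \<in> orth P (val P A)" by (simp only: subset_orth_single_iff)
    from boxed[OF this, of _ Future] show ?case
      by (auto simp: orth_def[of P "{_}"] intro!: derivable.box[simplified])
  next
    case (BBox A)
    then have "{#Fm A#} \<in> orth P (val P A)" by (simp only: subset_orth_single_iff)
    from boxed[OF this, of _ Past] show ?case
      by (auto simp: orth_def[of P "{_}"] intro!: derivable.bbox[simplified])
  next
    case (Dia A)
    from modal[OF this, of Future] show ?case by simp
  next
    case (BDia A)
    from modal[OF this, of Past] show ?case by simp
  qed simp
  then show ?thesis
    by (simp only: subset_orth_single_iff)
qed

section \<open>Replacing formulae by sequents\<close>

text \<open>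
  \<open>inst P i\<close> and \<open>insts P \<Gamma>\<close> collect the results of replacing each formula occurrence \<open>A\<close>
  by some sequent orthogonal to \<open>val P A\<close>, independently for different occurrences; the sums
  are elementwise sums of sets of sequents.
\<close>

primrec inst :: "path_axiom set \<Rightarrow> 'a item \<Rightarrow> 'a sequent set" where
  "inst P (Fm A) = orth P (val P A)"
| "inst P (Circ \<Delta>) = (\<lambda>\<Delta>'. {#Circ \<Delta>'#}) ` \<Sum>\<^sub># (image_mset (inst P) \<Delta>)"
| "inst P (Bullet \<Delta>) = (\<lambda>\<Delta>'. {#Bullet \<Delta>'#}) ` \<Sum>\<^sub># (image_mset (inst P) \<Delta>)"

definition insts :: "path_axiom set \<Rightarrow> 'a sequent \<Rightarrow> 'a sequent set" where
  "insts P \<Gamma> = \<Sum>\<^sub># (image_mset (inst P) \<Gamma>)"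

lemma insts_empty [simp]: "insts P {#} = {{#}}"
  by (simp add: insts_def set_zero)

lemma insts_add_mset [simp]: "insts P (add_mset i \<Gamma>) = inst P i + insts P \<Gamma>"
  by (simp add: insts_def)

lemma insts_plus [simp]: "insts P (\<Gamma> + \<Delta>) = insts P \<Gamma> + insts P \<Delta>"
  by (simp add: insts_def)

lemma inst_star [simp]: "inst P (star t \<Delta>) = (\<lambda>\<Delta>'. {#star t \<Delta>'#}) ` insts P \<Delta>"
  by (cases t) (simp_all add: insts_def)

lemma insts_single [simp]: "insts P {#i#} = inst P i"
  by (simp add: insts_def)

text \<open>Replacement leaves the nesting intact, so an instance of a path rule remains an instance
  of the same rule.\<close>

lemma insts_nest: "insts P (nest ts \<Delta>) = nest ts ` insts P \<Delta>"
  by (induction ts) (auto simp: image_image)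

lemma insts_selfI: "(\<And>i. i \<in># \<Gamma> \<Longrightarrow> {#i#} \<in> inst P i) \<Longrightarrow> \<Gamma> \<in> insts P \<Gamma>"
proof (induction \<Gamma>)
  case (add i \<Gamma>)
  then have "{#i#} + \<Gamma> \<in> inst P i + insts P \<Gamma>"
    by (intro set_plus_intro) auto
  then show ?case by simp
qed simp

lemma inst_self: "{#i#} \<in> inst P i"
proof (induction i)
  case (Circ \<Delta>)
  then show ?case using inst_star[of P Future \<Delta>] insts_selfI[of \<Delta> P] by simp
next
  case (Bullet \<Delta>)
  then show ?case using inst_star[of P Past \<Delta>] insts_selfI[of \<Delta> P] by simp
qed (simp add: formula_in_orth_val)

section \<open>Soundness of the calculus with cut\<close>

definition valid :: "path_axiom set \<Rightarrow> 'a sequent \<Rightarrow> bool" where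
  "valid P \<Gamma> \<longleftrightarrow> (\<forall>\<Gamma>'\<in>insts P \<Gamma>. SKt_cut_free P \<Gamma>')"

lemma valid_plus:
  "valid P (\<Gamma> + \<Delta>) \<longleftrightarrow> (\<forall>\<Gamma>'\<in>insts P \<Gamma>. \<forall>\<Delta>'\<in>insts P \<Delta>. SKt_cut_free P (\<Gamma>' + \<Delta>'))"
  by (auto simp: valid_def elim: set_plus_elim)

text \<open>The replacements of \<open>A\<close> range over \<open>orth P (val P A)\<close>, so
  validity places the context in the biorthogonal, which is \<open>val P A\<close> by
  closure.\<close>

lemma valid_formula: "valid P (\<Gamma> + {#Fm A#}) \<longleftrightarrow> insts P \<Gamma> \<subseteq> val P A"
proof -
  have "valid P (\<Gamma> + {#Fm A#}) \<longleftrightarrow> insts P \<Gamma> \<subseteq> orth P (orth P (val P A))"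
    unfolding valid_plus by (auto simp: orth_def[of _ "orth _ _"])
  then show ?thesis by simp
qed

lemma valid_star:
  "valid P (\<Gamma> + {#star t \<Delta>#}) \<longleftrightarrow>
    (\<forall>\<Gamma>'\<in>insts P \<Gamma>. \<forall>\<Delta>'\<in>insts P \<Delta>. SKt_cut_free P (\<Gamma>' + {#star t \<Delta>'#}))"
  unfolding valid_plus insts_single inst_star by blast

lemma valid_residuation:
  assumes "valid P (\<Gamma> + {#star t \<Delta>#})"
  shows "valid P (\<Delta> + {#star (conv t) \<Gamma>#})"
  using assms unfolding valid_star by (blast intro: residuation1)

lemma valid_box:
  assumes "valid P (\<Gamma> + {#star t {#Fm A#}#})"
  shows "insts P \<Gamma> \<subseteq> orth P ((\<lambda>\<Delta>. {#star t \<Delta>#}) ` orth P (val P A))"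
  using assms unfolding valid_star by (auto simp: orth_def[of _ "_ ` _"])

text \<open>Residuation displays the body of the structure, storing the context \<Gamma>' in a
  converse structure, so that membership in \<open>val P A\<close> can be tested and \<Theta>
  applied.\<close>

lemma valid_dia:
  assumes "valid P (\<Gamma> + {#star t (\<Delta> + {#Fm A#})#})"
  shows "valid P (\<Gamma> + {#star t \<Delta>#} + {#Fm (dia t A)#})"
  unfolding valid_plus
proof (clarsimp simp: val_dia del: set_plus_elim elim!: set_plus_elim)
  fix \<Gamma>' \<Delta>' \<Theta>
  assume \<Gamma>': "\<Gamma>' \<in> insts P \<Gamma>" and \<Delta>': "\<Delta>' \<in> insts P \<Delta>"
    and \<Theta>: "\<Theta> \<in> orth P ((\<lambda>\<Delta>. {#star t \<Delta>#}) ` val P A)"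
  have "\<Delta>' + {#star (conv t) \<Gamma>'#} \<in> orth P (orth P (val P A))"
  proof (rule orthI)
    fix \<Psi> assume "\<Psi> \<in> orth P (val P A)"
    then have "\<Delta>' + \<Psi> \<in> insts P (\<Delta> + {#Fm A#})"
      using \<Delta>' unfolding insts_plus insts_single inst.simps by (intro set_plus_intro)
    then have "SKt_cut_free P (\<Gamma>' + {#star t (\<Delta>' + \<Psi>)#})"
      using assms \<Gamma>' unfolding valid_star by blast
    from residuation1[OF this] show "SKt_cut_free P (\<Delta>' + {#star (conv t) \<Gamma>'#} + \<Psi>)"
      by (simp add: ac_simps)
  qed
  then have "\<Delta>' + {#star (conv t) \<Gamma>'#} \<in> val P A"
    by (simp only: biorth_val)
  then have "SKt_cut_free P (\<Theta> + {#star t (\<Delta>' + {#star (conv t) \<Gamma>'#})#})"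
    using \<Theta> by (blast intro: orthD)
  then have "SKt_cut_free P (\<Delta>' + {#star (conv t) \<Gamma>'#} + {#star (conv t) \<Theta>#})"
    by (rule residuation1)
  \<comment> \<open>Displaying the body again leaves \<Gamma>' and \<Theta> in separate converse
    structures; they must be merged before going back.\<close>
  then have "SKt_cut_free P (\<Delta>' + {#star (conv t) (\<Gamma>' + \<Theta>)#})"
    by (rule merge_nested)
  from residuation1[OF this] show "SKt_cut_free P (add_mset (star t \<Delta>') (\<Gamma>' + \<Theta>))"
    by simp
qed

lemma soundness:
  assumes "SKt P \<Gamma>"
  shows "valid P \<Gamma>"
  using assms
proof (induction rule: derivable.induct)
  case (id \<Gamma> a)
  have "SKt_cut_free P (\<Gamma>' + (\<Delta> + \<Theta>))"
    if "\<Delta> \<in> orth P (val P (Pos a))" "\<Theta> \<in> orth P (val P (Neg a))" for \<Gamma>' \<Delta> \<Theta>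
  proof -
    \<comment> \<open>Here \<Theta> is orthogonal to \<open>Pos a\<close> and \<Delta> lies in the
      biorthogonal of \<open>Pos a\<close>.\<close>
    have "SKt_cut_free P (\<Delta> + \<Theta>)"
      using that by (auto simp: orth_def[of P "orth P (orth P _)"] intro: orthD)
    from derivable.wk[OF this, of \<Gamma>'] show ?thesis by (simp add: ac_simps)
  qed
  then show ?case
    unfolding valid_plus by (auto elim!: set_plus_elim)
next
  case (cut \<Gamma> A \<Delta>)
  \<comment> \<open>The contexts of the two premises take values in orthogonal sets, so their union
    is cut-free derivable by definition.\<close>
  then have "insts P \<Gamma> \<subseteq> val P A" "insts P \<Delta> \<subseteq> orth P (val P A)"
    by (simp_all only: valid_formula val_dual)
  then show ?case
    unfolding valid_plus by (metis add.commute orthD subsetD)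
next
  case (conj \<Gamma> A B)
  then show ?case
    by (simp only: valid_formula val.simps Int_subset_iff)
next
  case (disj \<Gamma> A B)
  have "\<Gamma>' \<in> val P (Or A B)" if "\<Gamma>' \<in> insts P \<Gamma>" for \<Gamma>'
    unfolding val.simps
  proof (rule orthI)
    fix \<Delta> assume "\<Delta> \<in> orth P (val P A) \<inter> orth P (val P B)"
    \<comment> \<open>One sequent may replace both disjuncts; its two copies are contracted
      afterwards.\<close>
    then have "\<Delta> + \<Delta> \<in> insts P {#Fm A, Fm B#}"
      by (auto simp: set_plus_intro)
    then have "SKt_cut_free P (\<Gamma>' + \<Delta> + \<Delta>)"
      using disj.IH that unfolding valid_plus add.assoc by blast
    then show "SKt_cut_free P (\<Gamma>' + \<Delta>)"
      by (rule derivable.ctr)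
  qed
  then show ?case
    unfolding valid_formula by blast
next
  case (ctr \<Gamma> \<Delta>)
  show ?case
    unfolding valid_plus
  proof (intro ballI)
    fix \<Gamma>' \<Delta>' assume "\<Gamma>' \<in> insts P \<Gamma>" "\<Delta>' \<in> insts P \<Delta>"
    \<comment> \<open>Among the independent replacements of the two copies of \<Delta>, take equal
      ones.\<close>
    then have "SKt_cut_free P (\<Gamma>' + \<Delta>' + \<Delta>')"
      using ctr.IH unfolding valid_plus[of P "\<Gamma> + \<Delta>"] by (auto intro: set_plus_intro)
    then show "SKt_cut_free P (\<Gamma>' + \<Delta>')"
      by (rule derivable.ctr)
  qed
next
  case (wk \<Gamma> \<Delta>)
  then show ?case
    unfolding valid_plus by (auto simp: valid_def intro: derivable.wk)
next
  case (rf \<Gamma> \<Delta>)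
  then show ?case
    using valid_residuation[of P \<Gamma> Future \<Delta>] by (simp add: add.commute)
next
  case (rp \<Gamma> \<Delta>)
  then show ?case
    using valid_residuation[of P \<Gamma> Past \<Delta>] by (simp add: add.commute)
next
  case (bbox \<Gamma> A)
  then show ?case
    using valid_box[of P \<Gamma> Past A] by (simp only: valid_formula val.simps star.simps)
next
  case (box \<Gamma> A)
  then show ?case
    using valid_box[of P \<Gamma> Future A] by (simp only: valid_formula val.simps star.simps)
next
  case (bdia \<Gamma> \<Delta> A)
  then show ?case
    using valid_dia[of P \<Gamma> Past \<Delta> A] by (simp add: add_mset_commute)
next
  case (dia \<Gamma> \<Delta> A)
  then show ?case
    using valid_dia[of P \<Gamma> Future \<Delta> A] by (simp add: add_mset_commute)
next
  case (path ts t \<Gamma> \<Delta>)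
  then show ?case
    unfolding valid_star by (auto simp: valid_plus insts_nest intro: derivable.path)
qed

theorem theorem6p3:
  fixes P :: "path_axiom set" and \<Gamma> :: "'a sequent"
  assumes "SKt P \<Gamma>"
  shows "SKt_cut_free P \<Gamma>"
  using soundness[OF assms] insts_selfI[OF inst_self] unfolding valid_def by blast

end
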